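(* Let $X=X_1\uplus\cdots\uplus X_M$ with $|X_i|=m_i\ge1$, and consider simple families $\mathcal{F}$ of subsets of $X$ such that for all distinct $E,F\in\mathcal{F}$ there is a $j\in[M]$ such that $E\cap X_j$ and $F\cap X_j$ are incomparable (neither contains the other). If $\mathcal{F}$ has maximum size among these families, then $$|\mathcal{F}|=\prod_{i=1}^M\binom{m_i}{\lfloor m_i/2\rfloor}.$$ A family $\mathcal{F}$ of this kind is a maximum size homogeneous family precisely when $\mathcal{F}$ consists of all subsets $F\subseteq X$ with $|F\cap X_i|=\ell_i$ for all $i$, for some $(\ell_1,\ldots,\ell_M)$ with $\ell_i\in\{\lfloor m_i/2\rfloor,\lceil m_i/2\rceil\}$ for each $i\in[M]$ (equivalently, its profile matrix is $S(\{(\ell_1,\ldots,\ell_M)\})$). In particular, when all $m_i$ are even, the maximum size family is unique and homogeneous.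
   Context: A family is homogeneous if membership of a subset $F\subseteq X$ depends only on its profile vector $(|F\cap X_1|,\ldots,|F\cap X_M|)$. For $I\subseteq\prod_i\{0,\ldots,m_i\}$, $S(I)$ is the matrix indexed by $\prod_i\{0,\ldots,m_i\}$ with entry $\prod_j\binom{m_j}{i_j}$ at $(i_1,\ldots,i_M)\in I$ and $0$ elsewhere. *)

theory Defs
  imports Main "HOL-Library.FuncSet" "HOL-Library.Disjoint_Sets"
begin

text \<open>The ground set is the union of the parts \<open>X 1, \<dots>, X M\<close>. Vectors and indices of
  \<open>M\<close>-dimensional matrices are extensional functions on \<open>{1..M}\<close> (\<open>undefined\<close> elsewhere), and
  matrices are extensional functions on the index box, so that HOL equality is equality of
  vectors, respectively of matrices.\<close>

definition ground :: "nat \<Rightarrow> (nat \<Rightarrow> 'a set) \<Rightarrow> 'a set" where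
  "ground M X = (\<Union>i\<in>{1..M}. X i)"

definition incomparable :: "'a set \<Rightarrow> 'a set \<Rightarrow> bool" where
  "incomparable A B \<longleftrightarrow> \<not> A \<subseteq> B \<and> \<not> B \<subseteq> A"

definition admissible :: "nat \<Rightarrow> (nat \<Rightarrow> 'a set) \<Rightarrow> 'a set set \<Rightarrow> bool" where
  "admissible M X \<F> \<longleftrightarrow> \<F> \<subseteq> Pow (ground M X) \<and>
     (\<forall>E\<in>\<F>. \<forall>F\<in>\<F>. E \<noteq> F \<longrightarrow> (\<exists>j\<in>{1..M}. incomparable (E \<inter> X j) (F \<inter> X j)))"

definition max_admissible :: "nat \<Rightarrow> (nat \<Rightarrow> 'a set) \<Rightarrow> 'a set set \<Rightarrow> bool" where
  "max_admissible M X \<F> \<longleftrightarrow> admissible M X \<F> \<and>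
     (\<forall>\<G>. admissible M X \<G> \<longrightarrow> card \<G> \<le> card \<F>)"

definition profile :: "nat \<Rightarrow> (nat \<Rightarrow> 'a set) \<Rightarrow> 'a set \<Rightarrow> nat \<Rightarrow> nat" where
  "profile M X F = (\<lambda>i\<in>{1..M}. card (F \<inter> X i))"

definition homogeneous :: "nat \<Rightarrow> (nat \<Rightarrow> 'a set) \<Rightarrow> 'a set set \<Rightarrow> bool" where
  "homogeneous M X \<F> \<longleftrightarrow> (\<forall>E F. E \<subseteq> ground M X \<longrightarrow> F \<subseteq> ground M X \<longrightarrow>
     profile M X E = profile M X F \<longrightarrow> (E \<in> \<F> \<longleftrightarrow> F \<in> \<F>))"

definition index_box :: "nat \<Rightarrow> (nat \<Rightarrow> nat) \<Rightarrow> (nat \<Rightarrow> nat) set" where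
  "index_box M m = (\<Pi>\<^sub>E i\<in>{1..M}. {0..m i})"

definition profile_matrix ::
  "nat \<Rightarrow> (nat \<Rightarrow> nat) \<Rightarrow> (nat \<Rightarrow> 'a set) \<Rightarrow> 'a set set \<Rightarrow> (nat \<Rightarrow> nat) \<Rightarrow> nat" where
  "profile_matrix M m X \<F> = (\<lambda>v\<in>index_box M m. card {F \<in> \<F>. profile M X F = v})"

definition S_matrix ::
  "nat \<Rightarrow> (nat \<Rightarrow> nat) \<Rightarrow> (nat \<Rightarrow> nat) set \<Rightarrow> (nat \<Rightarrow> nat) \<Rightarrow> nat" where
  "S_matrix M m I =
     (\<lambda>v\<in>index_box M m. if v \<in> I then (\<Prod>j\<in>{1..M}. m j choose v j) else 0)"

definition full_level :: "nat \<Rightarrow> (nat \<Rightarrow> 'a set) \<Rightarrow> (nat \<Rightarrow> nat) \<Rightarrow> 'a set set" where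
  "full_level M X l = {F. F \<subseteq> ground M X \<and> (\<forall>i\<in>{1..M}. card (F \<inter> X i) = l i)}"

text \<open>On \<open>nat\<close>, \<open>n div 2\<close> is the floor and \<open>(n + 1) div 2\<close> the ceiling of \<open>n / 2\<close>.\<close>

definition middle_vectors :: "nat \<Rightarrow> (nat \<Rightarrow> nat) \<Rightarrow> (nat \<Rightarrow> nat) set" where
  "middle_vectors M m = (\<Pi>\<^sub>E i\<in>{1..M}. {m i div 2, (m i + 1) div 2})"

end

theory Submission imports Defs Complex_Main begin

text \<open>A product of chains, one in each \<open>X i\<close>, meets an admissible family at most once. Averaging
  over maximal chains, one part at a time, yields an LYM inequality: the reciprocals of
  \<open>\<Prod>i. m i choose card (F \<inter> X i)\<close> add up to at most 1. Every such product is at most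
  \<open>\<Prod>i. m i choose (m i div 2)\<close>, with equality only for profiles in the middle; so the bound on
  \<open>card \<F>\<close> follows, and a family attaining it has only middle profiles. As each middle level is
  itself admissible and attains the bound, a maximum family that contains, or is contained in, a
  middle level equals it.\<close>

section \<open>Weighted LYM inequality, for one part and for products of parts\<close>

text \<open>LYM without counting chains: a maximal chain of \<open>X\<close> is \<open>X\<close> itself on top of a maximal chain
  of \<open>X - {x}\<close>, with \<open>x \<in> X\<close> chosen uniformly.\<close>

lemma weighted_sum_le_chain_bound:
  fixes f :: "'a set \<Rightarrow> real"
  assumes "finite X"
    and "\<And>C. C \<subseteq> Pow X \<Longrightarrow> chain\<^sub>\<subseteq> C \<Longrightarrow> sum f C \<le> c"
  shows "(\<Sum>A\<in>Pow X. f A / real (card X choose card A)) \<le> c"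
  using assms
proof (induction "card X" arbitrary: X c)
  case 0
  then show ?case
    using "0.prems"(2)[of "{{}}"] by (simp add: chain_subset_def)
next
  case (Suc n)
  define P where "P = Pow X - {X}"
  define g where "g = (\<lambda>A. f A / real (n choose card A))"
  have finP: "finite P"
    using Suc.prems(1) by (simp add: P_def)
  \<comment> \<open>Adding \<open>X\<close> on top of a chain in \<open>X - {x}\<close> gives a
    chain in \<open>X\<close>, so the smaller chain has only \<open>c - f X\<close> left; this is
    why the induction varies \<open>c\<close>.\<close>
  have deleted: "(\<Sum>A\<in>Pow (X - {x}). g A) \<le> c - f X" if "x \<in> X" for x
  proof -
    have card: "n = card (X - {x})"
      using Suc.hyps(2) Suc.prems(1) that by simp
    have "sum f C \<le> c - f X" if C: "C \<subseteq> Pow (X - {x})" "chain\<^sub>\<subseteq> C" for C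
    proof -
      have "X \<notin> C" "finite C"
        using C(1) \<open>x \<in> X\<close> Suc.prems(1) by (auto intro: finite_subset[of _ "Pow X"])
      moreover have "sum f (insert X C) \<le> c"
        using C by (intro Suc.prems(2)) (auto simp: chain_subset_def)
      ultimately show ?thesis by simp
    qed
    then show ?thesis
      using Suc.hyps(1)[OF card] Suc.prems(1) unfolding g_def card[symmetric] by simp
  qed
  \<comment> \<open>A proper subset \<open>A\<close> survives the deletion of \<open>x\<close> for
    \<open>card (X - A)\<close> choices of \<open>x\<close>. Binomial absorption turns this
    multiplicity times \<open>g A\<close> into \<open>Suc n\<close> times the summand of
    \<open>A\<close> for \<open>X\<close>.\<close>
  have weight: "real (card (X - A)) * g A = real (Suc n) * (f A / real (card X choose card A))"
    if "A \<in> P" for A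
  proof -
    have "A \<subset> X" using that by (auto simp: P_def)
    then have k: "card A < Suc n" "card (X - A) = Suc n - card A"
      using Suc.hyps(2) Suc.prems(1) psubset_card_mono[of X A]
      by (auto simp: card_Diff_subset finite_subset)
    have "real (Suc n - card A) * real (Suc n choose card A) = real (Suc n) * real (n choose card A)"
      using binomial_absorb_comp[of "Suc n" "card A"] by (metis diff_Suc_1 of_nat_mult)
    moreover have pos: "n choose card A > 0" "Suc n choose card A > 0"
      using k by (simp_all del: binomial_Suc_n)
    ultimately have "real (Suc n - card A)
        = real (Suc n) * real (n choose card A) / real (Suc n choose card A)"
      by (metis nonzero_eq_divide_eq of_nat_0_less_iff less_irrefl)
    with pos(1) show ?thesis
      unfolding g_def k(2) Suc.hyps(2)[symmetric] by simp
  qed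
  \<comment> \<open>Double counting of the pairs \<open>(A, x)\<close> with \<open>A\<close> in
    \<open>P\<close> and \<open>x\<close> in \<open>X - A\<close>.\<close>
  have "real (Suc n) * (\<Sum>A\<in>P. f A / real (card X choose card A))
      = (\<Sum>A\<in>P. \<Sum>x\<in>{x. x \<in> X \<and> x \<notin> A}. g A)"
    unfolding sum_distrib_left using weight by (intro sum.cong) (auto simp: set_diff_eq)
  also have "\<dots> = (\<Sum>x\<in>X. \<Sum>A\<in>{A. A \<in> P \<and> x \<notin> A}. g A)"
    by (rule sum.swap_restrict[OF finP Suc.prems(1)])
  also have "\<dots> = (\<Sum>x\<in>X. \<Sum>A\<in>Pow (X - {x}). g A)"
    by (intro sum.cong) (auto simp: P_def)
  also have "\<dots> \<le> real (Suc n) * (c - f X)"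
    using sum_bounded_above[OF deleted, of X] Suc.hyps(2) by simp
  finally have "(\<Sum>A\<in>P. f A / real (card X choose card A)) \<le> c - f X"
    by (simp add: mult_le_cancel_left_pos del: of_nat_Suc)
  \<comment> \<open>The summand of \<open>X\<close> itself has denominator 1 and uses up the
    reserved \<open>f X\<close>.\<close>
  moreover have "Pow X = insert X P" "X \<notin> P"
    by (auto simp: P_def)
  ultimately show ?case
    using finP by simp
qed

text \<open>Induction on the set of parts. Members whose traces on \<open>X i\<close> lie in one
  chain must be separated by the other parts, so by induction their weights over those parts sum to
  at most 1. This is the chain hypothesis of the preceding lemma on \<open>X i\<close>, with
  \<open>c = 1\<close>.\<close>

lemma LYM_product:
  assumes "finite I" and "\<And>i. i \<in> I \<Longrightarrow> finite (X i)" and "finite \<G>"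
    and "\<And>E F. E \<in> \<G> \<Longrightarrow> F \<in> \<G> \<Longrightarrow> E \<noteq> F \<Longrightarrow> \<exists>j\<in>I. incomparable (E \<inter> X j) (F \<inter> X j)"
  shows "(\<Sum>F\<in>\<G>. \<Prod>i\<in>I. 1 / real (card (X i) choose card (F \<inter> X i))) \<le> 1"
  using assms
proof (induction I arbitrary: \<G> rule: finite_induct)
  case empty
  \<comment> \<open>With no parts left nothing separates distinct members, and the empty product is
    1.\<close>
  then have "card \<G> \<le> 1"
    by (auto simp: card_le_Suc0_iff_eq)
  then show ?case by simp
next
  case (insert i I)
  define w where "w = (\<lambda>F. \<Prod>i\<in>I. 1 / real (card (X i) choose card (F \<inter> X i)))"
  define f where "f = (\<lambda>A. \<Sum>F\<in>{F\<in>\<G>. F \<inter> X i = A}. w F)"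
  have fin: "finite (X i)" using insert.prems(1) by simp
  have "sum f C \<le> 1" if C: "C \<subseteq> Pow (X i)" "chain\<^sub>\<subseteq> C" for C
  proof -
    define \<H> where "\<H> = {F\<in>\<G>. F \<inter> X i \<in> C}"
    have "finite C" using C(1) fin by (meson finite_Pow_iff finite_subset)
    then have "sum f C = (\<Sum>A\<in>C. sum w {F\<in>\<H>. F \<inter> X i = A})"
      unfolding f_def \<H>_def by (intro sum.cong) auto
    also have "\<dots> = sum w \<H>"
      using insert.prems(2) \<open>finite C\<close> by (intro sum.group) (auto simp: \<H>_def)
    also have "\<dots> \<le> 1"
      unfolding w_def
    proof (rule insert.IH)
      fix E F assume EF: "E \<in> \<H>" "F \<in> \<H>" "E \<noteq> F"
      then have "\<exists>j\<in>insert i I. incomparable (E \<inter> X j) (F \<inter> X j)"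
        using insert.prems(3) by (auto simp: \<H>_def)
      moreover have "E \<inter> X i \<in> C" "F \<inter> X i \<in> C"
        using EF by (simp_all add: \<H>_def)
      then have "\<not> incomparable (E \<inter> X i) (F \<inter> X i)"
        using C(2) unfolding chain_subset_def incomparable_def by metis
      ultimately show "\<exists>j\<in>I. incomparable (E \<inter> X j) (F \<inter> X j)"
        by auto
    qed (use insert.prems in \<open>auto simp: \<H>_def\<close>)
    finally show ?thesis .
  qed
  then have "(\<Sum>A\<in>Pow (X i). f A / real (card (X i) choose card A)) \<le> 1"
    by (rule weighted_sum_le_chain_bound[OF fin])
  \<comment> \<open>The denominator depends only on the trace \<open>A\<close>, so it moves into the
    inner sum; ungrouping then supplies the factor for part \<open>i\<close>.\<close>
  also have "(\<Sum>A\<in>Pow (X i). f A / real (card (X i) choose card A))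
      = (\<Sum>A\<in>Pow (X i). \<Sum>F\<in>{F\<in>\<G>. F \<inter> X i = A}.
           w F / real (card (X i) choose card (F \<inter> X i)))"
    unfolding f_def sum_divide_distrib by (intro sum.cong) auto
  also have "\<dots> = (\<Sum>F\<in>\<G>. w F / real (card (X i) choose card (F \<inter> X i)))"
    using insert.prems(2) fin by (intro sum.group) auto
  finally show ?case
    using insert.hyps by (simp add: w_def)
qed

section \<open>Binomial coefficients at the middle\<close>

lemma binomial_eq_maximum_imp:
  assumes "n choose k = n choose (n div 2)"
  shows "k \<in> {n div 2, (n + 1) div 2}"
proof (rule ccontr)
  assume k: "k \<notin> {n div 2, (n + 1) div 2}"
  \<comment> \<open>The two middle values are equal or consecutive, so \<open>k\<close> lies below
    both or above both. Strict decrease is available up to \<open>n\<close>; beyond it the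
    coefficient is 0.\<close>
  consider "k < n div 2" | "(n + 1) div 2 < k" "k \<le> n" | "n < k"
    using k by fastforce
  then show False
  proof cases
    case 1
    then show False using binomial_strict_mono[of k "n div 2" n] assms by simp
  next
    case 2
    then have "n choose k < n choose ((n + 1) div 2)"
      by (intro binomial_strict_antimono) auto
    also have "\<dots> \<le> n choose (n div 2)" by (rule binomial_maximum)
    finally show False using assms by simp
  next
    case 3
    then have "n choose (n div 2) = 0"
      using assms by (simp add: binomial_eq_0)
    then show False by simp
  qed
qed

text \<open>Floor and ceiling of \<open>n / 2\<close> add up to \<open>n\<close>, so symmetry
  applies.\<close>

lemma binomial_middle:
  assumes "k \<in> {n div 2, (n + 1) div 2}"
  shows "n choose k = n choose (n div 2)"
proof -
  have "n - n div 2 = (n + 1) div 2" by presburger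
  then show ?thesis
    using assms binomial_symmetric[of "n div 2" n] by auto
qed

section \<open>Full levels of the partitioned ground set\<close>

locale partitioned_ground =
  fixes M :: nat and m :: "nat \<Rightarrow> nat" and X :: "nat \<Rightarrow> 'a set"
  assumes disj: "disjoint_family_on X {1..M}"
    and finite_part: "i \<in> {1..M} \<Longrightarrow> finite (X i)"
    and card_part: "i \<in> {1..M} \<Longrightarrow> card (X i) = m i"
begin

lemma finite_ground: "finite (ground M X)"
  using finite_part by (simp add: ground_def)

lemma finite_family: "\<F> \<subseteq> Pow (ground M X) \<Longrightarrow> finite \<F>"
  using finite_ground by (meson finite_Pow_iff finite_subset)

lemma card_trace_le: "i \<in> {1..M} \<Longrightarrow> card (F \<inter> X i) \<le> m i"
  using card_mono[OF finite_part, of i "F \<inter> X i"] card_part by simp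

lemma Union_traces: "F \<subseteq> ground M X \<Longrightarrow> (\<Union>i\<in>{1..M}. F \<inter> X i) = F"
  by (auto simp: ground_def)

lemma full_level_subset: "full_level M X l \<subseteq> Pow (ground M X)"
  by (auto simp: full_level_def)

text \<open>A subset of the ground set amounts to a tuple of independently chosen traces, one in
  each part.\<close>

lemma card_full_level: "card (full_level M X l) = (\<Prod>i\<in>{1..M}. m i choose l i)"
proof -
  define T where "T = (\<Pi>\<^sub>E i\<in>{1..M}. {A. A \<subseteq> X i \<and> card A = l i})"
  \<comment> \<open>By disjointness, taking traces undoes taking the union of a tuple.\<close>
  have trace: "(\<Union>j\<in>{1..M}. g j) \<inter> X i = g i" if g: "g \<in> T" and i: "i \<in> {1..M}" for g i
  proof -
    have sub: "g j \<subseteq> X j" if "j \<in> {1..M}" for j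
      using g that unfolding T_def by (blast dest: PiE_mem)
    then have "g j \<inter> X i = {}" if "j \<in> {1..M}" "j \<noteq> i" for j
      using disj i that unfolding disjoint_family_on_def by blast
    with sub i show ?thesis by blast
  qed
  have "bij_betw (\<lambda>F. \<lambda>i\<in>{1..M}. F \<inter> X i) (full_level M X l) T"
  proof (rule bij_betw_byWitness[where f' = "\<lambda>g. \<Union>i\<in>{1..M}. g i"])
    show "\<forall>F\<in>full_level M X l. (\<Union>i\<in>{1..M}. (\<lambda>i\<in>{1..M}. F \<inter> X i) i) = F"
      using Union_traces by (auto simp: full_level_def)
    show "\<forall>g\<in>T. (\<lambda>i\<in>{1..M}. (\<Union>j\<in>{1..M}. g j) \<inter> X i) = g"
    proof
      fix g assume g: "g \<in> T"
      then have "g \<in> extensional {1..M}"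
        by (auto simp: T_def PiE_def)
      then show "(\<lambda>i\<in>{1..M}. (\<Union>j\<in>{1..M}. g j) \<inter> X i) = g"
        using trace[OF g] by (intro extensionalityI[of _ "{1..M}"]) auto
    qed
    show "(\<lambda>F. \<lambda>i\<in>{1..M}. F \<inter> X i) ` full_level M X l \<subseteq> T"
      by (auto simp: T_def full_level_def)
    show "(\<lambda>g. \<Union>i\<in>{1..M}. g i) ` T \<subseteq> full_level M X l"
    proof
      fix F assume "F \<in> (\<lambda>g. \<Union>i\<in>{1..M}. g i) ` T"
      then obtain g where g: "g \<in> T" "F = (\<Union>i\<in>{1..M}. g i)" by blast
      have "g i \<subseteq> X i \<and> card (g i) = l i" if "i \<in> {1..M}" for i
        using g(1) that unfolding T_def by (blast dest: PiE_mem)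
      with g trace show "F \<in> full_level M X l"
        unfolding full_level_def ground_def by fastforce
    qed
  qed
  then have "card (full_level M X l) = card T"
    by (rule bij_betw_same_card)
  also have "\<dots> = (\<Prod>i\<in>{1..M}. m i choose l i)"
    unfolding T_def card_PiE[OF finite_atLeastAtMost]
    using finite_part card_part by (intro prod.cong) (auto simp: n_subsets)
  finally show ?thesis .
qed

text \<open>Distinct subsets of the ground set differ in some trace, and distinct finite sets of
  equal size are incomparable.\<close>

lemma full_level_admissible: "admissible M X (full_level M X l)"
  unfolding admissible_def
proof (intro conjI ballI impI)
  fix E F assume E: "E \<in> full_level M X l" and F: "F \<in> full_level M X l" and "E \<noteq> F"
  then have "(\<Union>i\<in>{1..M}. E \<inter> X i) \<noteq> (\<Union>i\<in>{1..M}. F \<inter> X i)"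
    using full_level_subset Union_traces by (metis PowD subsetD)
  then obtain j where j: "j \<in> {1..M}" "E \<inter> X j \<noteq> F \<inter> X j" by (meson SUP_cong)
  have "card (E \<inter> X j) = card (F \<inter> X j)"
    using E F j(1) by (simp add: full_level_def)
  then have "incomparable (E \<inter> X j) (F \<inter> X j)"
    using j finite_part[OF j(1)] unfolding incomparable_def
    by (metis card_subset_eq finite_Int)
  with j(1) show "\<exists>j\<in>{1..M}. incomparable (E \<inter> X j) (F \<inter> X j)" by blast
qed (rule full_level_subset)

section \<open>The size bound and its equality case\<close>

definition bound :: nat where
  "bound = (\<Prod>i\<in>{1..M}. m i choose (m i div 2))"

text \<open>For \<open>F\<close> inside the ground set this is the size of the full level containing
  \<open>F\<close>; its reciprocal is the LYM weight of \<open>F\<close>.\<close>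

definition level_size :: "'a set \<Rightarrow> nat" where
  "level_size F = (\<Prod>i\<in>{1..M}. m i choose card (F \<inter> X i))"

lemma bound_pos: "bound > 0"
  by (auto simp: bound_def intro!: prod_pos)

lemma level_size_pos: "level_size F > 0"
  using card_trace_le by (auto simp: level_size_def intro!: prod_pos)

lemma level_size_le: "level_size F \<le> bound"
  unfolding level_size_def bound_def by (intro prod_mono) (auto simp: binomial_maximum)

lemma LYM_admissible:
  assumes "admissible M X \<F>"
  shows "(\<Sum>F\<in>\<F>. 1 / real (level_size F)) \<le> 1"
proof -
  have "(\<Sum>F\<in>\<F>. \<Prod>i\<in>{1..M}. 1 / real (card (X i) choose card (F \<inter> X i))) \<le> 1"
    using assms finite_family finite_part by (intro LYM_product) (auto simp: admissible_def)
  moreover have "(\<Prod>i\<in>{1..M}. 1 / real (card (X i) choose card (F \<inter> X i))) = 1 / real (level_size F)"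
    for F
    using card_part by (simp add: level_size_def prod_dividef)
  ultimately show ?thesis by simp
qed

text \<open>Every member weighs at least \<open>1 / bound\<close>, and the total weight is at most
  1.\<close>

lemma card_le_bound:
  assumes "admissible M X \<F>"
  shows "card \<F> \<le> bound"
proof -
  have "real (card \<F>) * (1 / real bound) \<le> (\<Sum>F\<in>\<F>. 1 / real (level_size F))"
    using level_size_le level_size_pos by (intro sum_bounded_below) (simp add: frac_le)
  also note LYM_admissible[OF assms]
  finally show ?thesis using bound_pos by (simp add: field_simps)
qed

text \<open>Among \<open>bound\<close> members of weight at least \<open>1 / bound\<close>, a single
  heavier one would push the total above 1.\<close>

lemma level_size_eq_bound:
  assumes adm: "admissible M X \<F>" and card: "card \<F> = bound" and "F \<in> \<F>"
  shows "level_size F = bound"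
proof (rule ccontr)
  assume "level_size F \<noteq> bound"
  then have less: "1 / real bound < 1 / real (level_size F)"
    using level_size_le[of F] level_size_pos[of F] by (intro frac_less2) auto
  have "(\<Sum>F\<in>\<F>. 1 / real bound) < (\<Sum>F\<in>\<F>. 1 / real (level_size F))"
  proof (rule sum_strict_mono_ex1)
    show "finite \<F>" using adm finite_family by (auto simp: admissible_def)
    show "\<forall>F\<in>\<F>. 1 / real bound \<le> 1 / real (level_size F)"
      using level_size_le level_size_pos by (simp add: frac_le)
  qed (use less \<open>F \<in> \<F>\<close> in blast)
  also note LYM_admissible[OF adm]
  finally show False using card bound_pos by simp
qed

text \<open>One factor below its maximum makes the whole product strictly smaller, since all the
  maxima are positive.\<close>

lemma profile_middle:
  assumes "level_size F = bound"
  shows "profile M X F \<in> middle_vectors M m"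
proof -
  have "card (F \<inter> X j) \<in> {m j div 2, (m j + 1) div 2}" if j: "j \<in> {1..M}" for j
  proof (rule binomial_eq_maximum_imp, rule ccontr)
    assume "m j choose card (F \<inter> X j) \<noteq> m j choose (m j div 2)"
    then have "m j choose card (F \<inter> X j) < m j choose (m j div 2)"
      using binomial_maximum[of "m j" "card (F \<inter> X j)"] by simp
    then have "level_size F < bound"
      unfolding level_size_def bound_def
      using j by (intro prod_mono_strict[of j]) (auto simp: binomial_maximum)
    with assms show False by simp
  qed
  then show ?thesis by (auto simp: profile_def middle_vectors_def)
qed

lemma card_middle_level: "l \<in> middle_vectors M m \<Longrightarrow> card (full_level M X l) = bound"
  unfolding card_full_level bound_def middle_vectors_def
  by (intro prod.cong refl binomial_middle) (blast dest: PiE_mem)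

lemma middle_vectors_nonempty: "(\<lambda>i\<in>{1..M}. m i div 2) \<in> middle_vectors M m"
  by (auto simp: middle_vectors_def)

text \<open>A middle level attains the bound, so maximality becomes an equation of
  cardinalities.\<close>

lemma max_admissible_iff: "max_admissible M X \<F> \<longleftrightarrow> admissible M X \<F> \<and> card \<F> = bound"
  using card_le_bound full_level_admissible card_middle_level[OF middle_vectors_nonempty]
  unfolding max_admissible_def by (metis le_antisym)

section \<open>Homogeneous maximum families and profile matrices\<close>

lemma full_level_eq_profile:
  "l \<in> extensional {1..M} \<Longrightarrow> full_level M X l = {F. F \<subseteq> ground M X \<and> profile M X F = l}"
  by (auto simp: full_level_def profile_def intro!: extensionalityI[of _ "{1..M}"])

lemma middle_vector_extensional: "l \<in> middle_vectors M m \<Longrightarrow> l \<in> extensional {1..M}"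
  by (simp add: middle_vectors_def PiE_def)

lemma profile_in_box: "profile M X F \<in> index_box M m"
  using card_trace_le by (auto simp: profile_def index_box_def)

lemma middle_vectors_subset_box: "middle_vectors M m \<subseteq> index_box M m"
  unfolding middle_vectors_def index_box_def by (intro PiE_mono) auto

lemma full_level_homogeneous: "l \<in> extensional {1..M} \<Longrightarrow> homogeneous M X (full_level M X l)"
  by (simp add: homogeneous_def full_level_eq_profile)

text \<open>Homogeneity forces the whole level of any member into \<F>. By the equality case that
  level is a middle one, so it already has as many elements as \<F>.\<close>

lemma max_homogeneous_iff:
  "max_admissible M X \<F> \<and> homogeneous M X \<F> \<longleftrightarrow>
     (\<exists>l\<in>middle_vectors M m. \<F> = full_level M X l)"
proof
  assume "max_admissible M X \<F> \<and> homogeneous M X \<F>"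
  then have adm: "admissible M X \<F>" and card: "card \<F> = bound" and hom: "homogeneous M X \<F>"
    by (auto simp: max_admissible_iff)
  have sub: "\<F> \<subseteq> Pow (ground M X)" using adm by (simp add: admissible_def)
  obtain F where F: "F \<in> \<F>" using card bound_pos by fastforce
  define l where "l = profile M X F"
  have l: "l \<in> middle_vectors M m"
    unfolding l_def using level_size_eq_bound[OF adm card F] by (rule profile_middle)
  have "full_level M X l \<subseteq> \<F>"
    using hom F sub unfolding full_level_eq_profile[OF middle_vector_extensional[OF l]]
    by (auto simp: homogeneous_def l_def)
  then have "full_level M X l = \<F>"
    using card_middle_level[OF l] card by (intro card_subset_eq finite_family[OF sub]) simp_all
  with l show "\<exists>l\<in>middle_vectors M m. \<F> = full_level M X l" by blast
next
  assume "\<exists>l\<in>middle_vectors M m. \<F> = full_level M X l"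
  then show "max_admissible M X \<F> \<and> homogeneous M X \<F>"
    using full_level_admissible card_middle_level full_level_homogeneous middle_vector_extensional
    by (auto simp: max_admissible_iff)
qed

text \<open>The nonzero entry of \<open>S_matrix M m {l}\<close> is the size of the full level at
  \<open>l\<close>. Conversely, the zero entries exclude every other profile, and the entry at
  \<open>l\<close> makes \<F> as large as the level containing it.\<close>

lemma full_level_iff_profile_matrix:
  assumes sub: "\<F> \<subseteq> Pow (ground M X)" and l: "l \<in> index_box M m"
  shows "\<F> = full_level M X l \<longleftrightarrow> profile_matrix M m X \<F> = S_matrix M m {l}"
proof
  have level: "full_level M X l = {F. F \<subseteq> ground M X \<and> profile M X F = l}"
    using l by (intro full_level_eq_profile) (simp add: index_box_def PiE_def)
  {
    assume \<F>: "\<F> = full_level M X l"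
    have "{F \<in> \<F>. profile M X F = v} = (if v = l then full_level M X l else {})" for v
      by (auto simp: \<F> level)
    then show "profile_matrix M m X \<F> = S_matrix M m {l}"
      unfolding profile_matrix_def S_matrix_def
      by (intro restrict_ext) (simp add: card_full_level)
  }
  assume eq: "profile_matrix M m X \<F> = S_matrix M m {l}"
  have entry: "card {F \<in> \<F>. profile M X F = v} = (if v = l then card (full_level M X l) else 0)"
    if "v \<in> index_box M m" for v
    using fun_cong[OF eq, of v] that
    by (auto simp: profile_matrix_def S_matrix_def card_full_level)
  have "profile M X F = l" if "F \<in> \<F>" for F
  proof (rule ccontr)
    assume "profile M X F \<noteq> l"
    then have "card {E \<in> \<F>. profile M X E = profile M X F} = 0"
      using entry[OF profile_in_box[of F]] by simp
    then show False
      using that finite_family[OF sub] by auto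
  qed
  then have "{F \<in> \<F>. profile M X F = l} = \<F>" and "\<F> \<subseteq> full_level M X l"
    using sub by (auto simp: level)
  then show "\<F> = full_level M X l"
    using entry[OF l] by (intro card_subset_eq finite_family[OF full_level_subset]) simp_all
qed

section \<open>Even part sizes\<close>

text \<open>Floor and ceiling of \<open>m i / 2\<close> coincide, so there is a single middle
  vector; its level contains \<F> and has the same size.\<close>

lemma max_admissible_even:
  assumes even: "\<forall>i\<in>{1..M}. even (m i)" and max: "max_admissible M X \<F>"
  shows "\<F> = full_level M X (\<lambda>i\<in>{1..M}. m i div 2)"
proof -
  let ?l = "\<lambda>i\<in>{1..M}. m i div 2"
  have adm: "admissible M X \<F>" and card: "card \<F> = bound"
    using max by (auto simp: max_admissible_iff)
  have singleton: "l = ?l" if "l \<in> middle_vectors M m" for l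
  proof (rule extensionalityI[OF middle_vector_extensional[OF that]])
    fix i assume "i \<in> {1..M}"
    then show "l i = ?l i"
      using that even by (auto simp: middle_vectors_def dest!: PiE_mem[of _ _ _ i])
  qed simp
  have "profile M X F = ?l" if "F \<in> \<F>" for F
    using profile_middle[OF level_size_eq_bound[OF adm card that]] by (rule singleton)
  then have "\<F> \<subseteq> full_level M X ?l"
    using adm by (auto simp: full_level_eq_profile admissible_def)
  then show ?thesis
    using card card_middle_level[OF middle_vectors_nonempty]
    by (intro card_subset_eq finite_family[OF full_level_subset]) simp_all
qed

end

theorem theorem6p3:
  fixes M :: nat and m :: "nat \<Rightarrow> nat" and X :: "nat \<Rightarrow> 'a set"
  assumes "disjoint_family_on X {1..M}"
    and "\<And>i. i \<in> {1..M} \<Longrightarrow> finite (X i)"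
    and "\<And>i. i \<in> {1..M} \<Longrightarrow> card (X i) = m i"
    and "\<And>i. i \<in> {1..M} \<Longrightarrow> 1 \<le> m i"
  shows "(\<forall>\<F>. max_admissible M X \<F> \<longrightarrow> card \<F> = (\<Prod>i\<in>{1..M}. m i choose (m i div 2))) \<and>
    (\<forall>\<F>. max_admissible M X \<F> \<and> homogeneous M X \<F> \<longleftrightarrow>
        (\<exists>l\<in>middle_vectors M m. \<F> = full_level M X l)) \<and>
    (\<forall>\<F>. \<F> \<subseteq> Pow (ground M X) \<longrightarrow> (\<forall>l\<in>middle_vectors M m.
        \<F> = full_level M X l \<longleftrightarrow> profile_matrix M m X \<F> = S_matrix M m {l})) \<and>
    ((\<forall>i\<in>{1..M}. even (m i)) \<longrightarrow>
        (\<exists>!\<F>. max_admissible M X \<F>) \<and>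
        (\<forall>\<F>. max_admissible M X \<F> \<longrightarrow> homogeneous M X \<F>))"
proof -
  interpret partitioned_ground M m X
    using assms(1-3) by unfold_locales
  \<comment> \<open>This level witnesses existence; in the even case every maximum family equals it
    and so is homogeneous.\<close>
  have mid: "max_admissible M X (full_level M X (\<lambda>i\<in>{1..M}. m i div 2)) \<and>
      homogeneous M X (full_level M X (\<lambda>i\<in>{1..M}. m i div 2))"
    using max_homogeneous_iff middle_vectors_nonempty by blast
  have size: "\<forall>\<F>. max_admissible M X \<F> \<longrightarrow> card \<F> = (\<Prod>i\<in>{1..M}. m i choose (m i div 2))"
    by (simp add: max_admissible_iff bound_def)
  have unique: "(\<exists>!\<F>. max_admissible M X \<F>) \<and> (\<forall>\<F>. max_admissible M X \<F> \<longrightarrow> homogeneous M X \<F>)"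
    if "\<forall>i\<in>{1..M}. even (m i)"
    using mid max_admissible_even[OF that] by metis
  have matrix: "\<forall>\<F>. \<F> \<subseteq> Pow (ground M X) \<longrightarrow> (\<forall>l\<in>middle_vectors M m.
      \<F> = full_level M X l \<longleftrightarrow> profile_matrix M m X \<F> = S_matrix M m {l})"
    using full_level_iff_profile_matrix middle_vectors_subset_box by (meson subsetD)
  have hom: "\<forall>\<F>. max_admissible M X \<F> \<and> homogeneous M X \<F> \<longleftrightarrow>
      (\<exists>l\<in>middle_vectors M m. \<F> = full_level M X l)"
    using max_homogeneous_iff by blast
  show ?thesis
    by (rule conjI[OF size conjI[OF hom conjI[OF matrix impI[OF unique]]]])
qed

end
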